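(* The integral form $32x^3+y^3+2z^3-12xyz$ represents a positive density of primes, i.e. a positive proportion of all primes $p$ is of the form $p=32x^3+y^3+2z^3-12xyz$ with $x,y,z\in\mathbb{Z}$.
   Context: That a set $Q$ of primes comprises a positive density (positive proportion) of the primes means $\liminf_{X\to\infty}\#\{p\in Q: p\leq X\}/\#\{p\text{ prime}: p\leq X\}>0$. *)

theory Defs
  imports "HOL-Analysis.Analysis" "HOL-Computational_Algebra.Primes"
begin

definition primes_upto :: "real \<Rightarrow> nat set" where
  "primes_upto X = {p. prime p \<and> real p \<le> X}"

(* For X < 2 the quotient is 0 / 0 = 0, which does not affect the limit inferior.
   The limit inferior is taken in ereal, where it always exists. *)
definition lower_prime_density :: "nat set \<Rightarrow> ereal" where
  "lower_prime_density Q =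
     Liminf at_top (\<lambda>X::real.
       ereal (real (card (Q \<inter> {p. real p \<le> X})) / real (card (primes_upto X))))"

definition positive_density_of_primes :: "nat set \<Rightarrow> bool" where
  "positive_density_of_primes Q \<longleftrightarrow> (\<forall>p\<in>Q. prime p) \<and> lower_prime_density Q > 0"

definition cubic_form :: "int \<Rightarrow> int \<Rightarrow> int \<Rightarrow> int" where
  "cubic_form x y z = 32 * x ^ 3 + y ^ 3 + 2 * z ^ 3 - 12 * x * y * z"

end

theory Submission
  imports "HOL-Number_Theory.Residues" "HOL-Number_Theory.Prime_Powers" Defs
begin

text \<open>Writing \<open>\<theta>\<close> for the real cube root of 2, the form is the norm of \<open>y + z\<theta> + 2x\<theta>\<^sup>2\<close>. Every prime
  \<open>p \<equiv> 2 (mod 3)\<close> is represented: 2 is a cube modulo \<open>p\<close>, so the box principle gives an element of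
  \<open>\<int>[\<theta>]\<close> of norm \<open>kp\<close> with \<open>0 < k \<le> 10\<close>; elements of norm 2, 3 and 5 remove the factor \<open>k\<close>, and
  multiplication by a power of the unit \<open>\<theta> - 1\<close> makes the last coordinate even. These primes have
  positive lower density by Chebyshev's method: the prime powers \<open>\<equiv> 2 (mod 3)\<close> up to \<open>x\<close> carry at least
  the weight of those \<open>\<equiv> 1 (mod 3)\<close> in \<open>(x/2, x]\<close>, because
  \<open>1 \<cdot> 4 \<cdots> (3n-2) \<le> 2 \<cdot> 5 \<cdots> (3n-1)\<close>.\<close>

subsection \<open>Primes congruent to 2 modulo 3 are represented\<close>

text \<open>\<open>cnorm a b c\<close> is the norm of \<open>a + b\<theta> + c\<theta>\<^sup>2\<close> for \<open>\<theta>\<^sup>3 = 2\<close>. The elements \<open>\<theta>\<close>, \<open>1 + \<theta>\<close>, \<open>1 + \<theta>\<^sup>2\<close>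
  have norms 2, 3, 5, and the prime 7 is inert.\<close>

definition cnorm :: "int \<Rightarrow> int \<Rightarrow> int \<Rightarrow> int" where
  "cnorm a b c = a ^ 3 + 2 * b ^ 3 + 4 * c ^ 3 - 6 * a * b * c"

section \<open>Removing small factors from a norm\<close>

lemma cnorm_minus: "cnorm (-a) (-b) (-c) = - cnorm a b c"
  by (simp add: cnorm_def)

text \<open>Division by \<theta>: once \<open>a = 2 * a'\<close>, the element is \<theta> times the
  one with coordinates \<open>b\<close>, \<open>c\<close>, \<open>a'\<close>.\<close>

lemma even_cnorm:
  assumes "cnorm a b c = 2 * n"
  obtains a' where "a = 2 * a'" "cnorm b c a' = n"
proof -
  have "a ^ 3 = 2 * (n - b ^ 3 - 2 * c ^ 3 + 3 * a * b * c)"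
    using assms by (simp add: cnorm_def algebra_simps)
  then have "even (a ^ 3)" by simp
  then obtain a' where a': "a = 2 * a'"
    by (auto elim: evenE)
  with assms have "cnorm b c a' = n"
    by (simp add: cnorm_def power3_eq_cube algebra_simps)
  with a' show thesis by (rule that)
qed

lemma cnorm_divide_2:
  assumes "cnorm a b c = 2 * n"
  shows "\<exists>a b c. cnorm a b c = n"
  by (rule even_cnorm[OF assms]) blast

text \<open>Modulo 3, X^3 - 2 is (X + 1)^3, so the norm is the cube of the value at \<theta> = -1.
  When this vanishes, 1 + \<theta> divides the element; \<open>u\<close>, \<open>v\<close>,
  \<open>w\<close> are the coordinates of the quotient.\<close>

lemma cnorm_divide_3:
  assumes "cnorm a b c = 3 * n"
  shows "\<exists>a b c. cnorm a b c = n"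
proof -
  have "[cnorm a b c = (a - b + c) ^ 3] (mod 3)"
    by (simp add: cong_iff_dvd_diff cnorm_def power3_eq_cube algebra_simps)
  then have "3 dvd (a - b + c) ^ 3"
    using assms by (metis cong_dvd_iff dvd_triv_left)
  then have "3 dvd a - b + c"
    by (rule prime_dvd_power[rotated]) simp
  then obtain w where w: "a - b + c = 3 * w" ..
  define v where "v = c - w"
  define u where "u = b - v"
  have abc: "a = u + 2 * w" "b = u + v" "c = v + w"
    using w by (auto simp: u_def v_def)
  have "cnorm a b c = 3 * cnorm u v w"
    unfolding abc cnorm_def by (simp add: power3_eq_cube algebra_simps)
  with assms show ?thesis by auto
qed

lemma cnorm_mod:
  "cnorm a b c mod m = cnorm (a mod m) (b mod m) (c mod m) mod m"
proof -
  have "[cnorm a b c = cnorm (a mod m) (b mod m) (c mod m)] (mod m)"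
    unfolding cnorm_def
    by (intro cong_diff cong_add cong_mult cong_pow cong_refl) (simp_all add: unique_euclidean_semiring_class.cong_def)
  then show ?thesis by (simp add: unique_euclidean_semiring_class.cong_def)
qed

lemma mod_5_cases: "(x :: int) mod 5 \<in> {0, 1, 2, 3, 4}"
  by auto
lemma mod_7_cases: "(x :: int) mod 7 \<in> {0, 1, 2, 3, 4, 5, 6}"
  by auto

text \<open>Modulo 5, X^3 - 2 is X - 3 times an irreducible quadratic. The alternatives say which of
  the two factors divides a + bX + cX^2.\<close>

lemma cnorm_zero_mod_5:
  "\<forall>a\<in>{0, 1, 2, 3, 4}. \<forall>b\<in>{0, 1, 2, 3, 4}. \<forall>c\<in>{0, 1, 2, 3, 4}. cnorm a b c mod 5 = 0 \<longrightarrow>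
     (2 * b - a + c) mod 5 = 0 \<or> (b - 2 * a) mod 5 = 0 \<and> (c + a) mod 5 = 0"
  by code_simp

text \<open>2 is not a cube modulo 7, so X^3 - 2 stays irreducible there and the norm becomes that
  of a field extension.\<close>

lemma cnorm_zero_mod_7:
  "\<forall>a\<in>{0, 1, 2, 3, 4, 5, 6}. \<forall>b\<in>{0, 1, 2, 3, 4, 5, 6}. \<forall>c\<in>{0, 1, 2, 3, 4, 5, 6}.
     cnorm a b c mod 7 = 0 \<longrightarrow> a = 0 \<and> b = 0 \<and> c = 0"
  by code_simp

text \<open>If the linear factor modulo 5 divides, the element is a multiple of 1 + \<theta>^2 with
  quotient \<open>u\<close>, \<open>v\<close>, \<open>w\<close>. If the quadratic factor divides,
  the norm is a multiple of 25, which \<open>\<not> 5 dvd n\<close> excludes.\<close>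

lemma cnorm_divide_5:
  assumes "cnorm a b c = 5 * n" "\<not> 5 dvd n"
  shows "\<exists>a b c. cnorm a b c = n"
proof -
  let ?a = "a mod 5" and ?b = "b mod 5" and ?c = "c mod 5"
  have "cnorm ?a ?b ?c mod 5 = 0"
    using assms cnorm_mod[of a b c 5] by simp
  then have "(2 * ?b - ?a + ?c) mod 5 = 0 \<or> (?b - 2 * ?a) mod 5 = 0 \<and> (?c + ?a) mod 5 = 0"
    using cnorm_zero_mod_5[THEN bspec, OF mod_5_cases, THEN bspec, OF mod_5_cases,
      THEN bspec, OF mod_5_cases, of a b c] by (rule mp[rotated])
  then have "(2 * b - a + c) mod 5 = 0 \<or> (b - 2 * a) mod 5 = 0 \<and> (c + a) mod 5 = 0"
    by presburger
  then consider w where "2 * b - a + c = 5 * w" | \<beta> \<gamma> where "b - 2 * a = 5 * \<beta>" "c + a = 5 * \<gamma>"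
    by (metis dvdE dvd_eq_mod_eq_0)
  then show ?thesis
  proof cases
    case 1
    define u where "u = c - w"
    define v where "v = b - 2 * w"
    have abc: "a = u + 2 * v" "b = v + 2 * w" "c = u + w"
      using 1 by (auto simp: u_def v_def)
    have "cnorm a b c = 5 * cnorm u v w"
      unfolding abc cnorm_def by (simp add: power3_eq_cube algebra_simps)
    with assms show ?thesis by auto
  next
    case 2
    have bc: "b = 2 * a + 5 * \<beta>" "c = 5 * \<gamma> - a"
      using 2 by auto
    have "25 dvd cnorm a b c"
      unfolding bc cnorm_def power3_eq_cube by (simp add: algebra_simps)
    with assms show ?thesis by presburger
  qed
qed

text \<open>All three coordinates must be multiples of 7, which puts 7^3 into the norm.\<close>

lemma cnorm_7:
  assumes "cnorm a b c = 7 * n"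
  shows "7 dvd n"
proof -
  have "cnorm (a mod 7) (b mod 7) (c mod 7) mod 7 = 0"
    using assms cnorm_mod[of a b c 7] by simp
  then have "a mod 7 = 0 \<and> b mod 7 = 0 \<and> c mod 7 = 0"
    using cnorm_zero_mod_7[THEN bspec, OF mod_7_cases, THEN bspec, OF mod_7_cases,
      THEN bspec, OF mod_7_cases, of a b c] by (rule mp[rotated])
  then obtain u v w where "a = 7 * u" "b = 7 * v" "c = 7 * w"
    by (metis dvdE dvd_eq_mod_eq_0)
  then have "7 * n = 7 * (7 * (7 * cnorm u v w))"
    using assms by (simp add: cnorm_def power3_eq_cube algebra_simps)
  then show ?thesis by simp
qed

text \<open>Infinite descent: three divisions by \<theta> halve every coordinate and keep the norm
  0.\<close>

lemma cnorm_eq_0D: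
  assumes "cnorm a b c = 0"
  shows "a = 0" "b = 0" "c = 0"
proof -
  have "a = 0 \<and> b = 0 \<and> c = 0"
    using assms
  proof (induction "nat (\<bar>a\<bar> + \<bar>b\<bar> + \<bar>c\<bar>)" arbitrary: a b c rule: less_induct)
    case less
    have "cnorm a b c = 2 * 0" using less.prems by simp
    then obtain a' where a: "a = 2 * a'" "cnorm b c a' = 0" by (rule even_cnorm)
    then have "cnorm b c a' = 2 * 0" by simp
    then obtain b' where b: "b = 2 * b'" "cnorm c a' b' = 0" by (rule even_cnorm)
    then have "cnorm c a' b' = 2 * 0" by simp
    then obtain c' where c: "c = 2 * c'" "cnorm a' b' c' = 0" by (rule even_cnorm)
    note * = a(1) b(1) c
    show ?case
    proof (rule ccontr)
      assume "\<not> ?case"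
      then have "nat (\<bar>a'\<bar> + \<bar>b'\<bar> + \<bar>c'\<bar>) < nat (\<bar>a\<bar> + \<bar>b\<bar> + \<bar>c\<bar>)"
        using * by auto
      from less.hyps[OF this *(4)] \<open>\<not> ?case\<close> * show False by simp
    qed
  qed
  then show "a = 0" "b = 0" "c = 0" by auto
qed

text \<open>Multiplication by the unit \<open>\<theta> - 1\<close>, whose powers represent all units modulo 2.\<close>

lemma cnorm_mult_unit: "cnorm (2 * c - a) (a - b) (b - c) = cnorm a b c"
  by (simp add: cnorm_def power3_eq_cube algebra_simps)

lemma cubic_form_eq_cnorm: "cubic_form x y z = cnorm y z (2 * x)"
  by (simp add: cubic_form_def cnorm_def power3_eq_cube)

text \<open>The form needs an even last coordinate. Modulo 2 the unit acts by (a, b, c) -> (a, a +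
  b, b + c); with \<open>a\<close> and \<open>c\<close> odd, one multiplication suffices if
  \<open>b\<close> is odd, two if \<open>b\<close> is even.\<close>

lemma cubic_form_represents_odd_cnorm:
  assumes "odd (cnorm a b c)"
  shows "\<exists>x y z. cubic_form x y z = cnorm a b c"
proof -
  have "odd a"
    using assms by (auto simp: cnorm_def)
  have *: "\<exists>x y z. cubic_form x y z = cnorm a b c" if "even c" for a b c
  proof -
    from that obtain x where "c = 2 * x" ..
    then show ?thesis using cubic_form_eq_cnorm[of x a b] by metis
  qed
  consider "even c" | "odd c" "odd b" | "odd c" "even b" by blast
  then show ?thesis
  proof cases
    case 1
    then show ?thesis by (rule *)
  next
    case 2
    then have "even (b - c)" by simp
    from *[OF this, of "2 * c - a" "a - b"] show ?thesis
      by (simp only: cnorm_mult_unit)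
  next
    case 3
    then have "even ((a - b) - (b - c))" using \<open>odd a\<close> by simp
    from *[OF this, of "2 * (b - c) - (2 * c - a)" "2 * c - a - (a - b)"] show ?thesis
      by (simp only: cnorm_mult_unit)
  qed
qed

text \<open>Factors 2 and 3 of \<open>k\<close> are divided out one at a time. A factor 5 occurs
  only once in \<open>k * p\<close>, as the division by 5 requires, and \<open>k = 7\<close> would
  force 7 to divide \<open>p\<close>.\<close>

lemma cnorm_divide_small:
  assumes p: "prime (p :: int)" "p \<notin> {2, 3, 5, 7}" and k: "0 < k" "k \<le> 10"
    and eq: "cnorm a b c = k * p"
  shows "\<exists>a b c. cnorm a b c = p"
proof -
  have ndvd: "\<not> 5 dvd p" "\<not> 7 dvd p"
    using p primes_dvd_imp_eq[of 5 p] primes_dvd_imp_eq[of 7 p] by auto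
  let ?R = "\<lambda>n. \<exists>a b c. cnorm a b c = n"
  have R2: "?R n" if "?R (2 * n)" for n using that cnorm_divide_2 by blast
  have R3: "?R n" if "?R (3 * n)" for n using that cnorm_divide_3 by blast
  have R: "?R (k * p)" using eq by blast
  consider "k = 1" | "k = 2" | "k = 3" | "k = 4" | "k = 5" | "k = 6" | "k = 7" | "k = 8"
    | "k = 9" | "k = 10"
    using k by atomize_elim presburger
  then show ?thesis
  proof cases
    case 1
    then show ?thesis using R by simp
  next
    case 2
    then show ?thesis using R R2[of p] by simp
  next
    case 3
    then show ?thesis using R R3[of p] by simp
  next
    case 4
    then show ?thesis using R R2[of p] R2[of "2 * p"] by simp
  next
    case 5
    then show ?thesis using eq cnorm_divide_5 ndvd by blast
  next
    case 6
    then show ?thesis using R R3[of p] R2[of "3 * p"] by simp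
  next
    case 7
    then show ?thesis using eq cnorm_7 ndvd by blast
  next
    case 8
    then show ?thesis using R R2[of p] R2[of "2 * p"] R2[of "4 * p"] by simp
  next
    case 9
    then show ?thesis using R R3[of p] R3[of "3 * p"] by simp
  next
    case 10
    then have "?R (5 * p)" using R R2[of "5 * p"] by simp
    then show ?thesis using cnorm_divide_5 ndvd by blast
  qed
qed

section \<open>A small multiple of p as a norm\<close>

lemma dvd_cnorm:
  assumes "[t ^ 3 = 2] (mod p)" "p dvd a + b * t + c * t\<^sup>2"
  shows "p dvd cnorm a b c"
proof -
  obtain r where r: "t ^ 3 = 2 + p * r"
    using assms(1) by (metis cong_iff_lin cong_sym)
  obtain s where s: "a + b * t + c * t\<^sup>2 = p * s"
    using assms(2) ..
  \<comment> \<open>The second factor is the product of the two other conjugates, written in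
    \<theta> and evaluated at \<open>t\<close>. The last summand corrects for \<open>t ^ 3\<close>
    being 2 only modulo \<open>p\<close>.\<close>
  have "cnorm a b c = (a + b * t + c * t\<^sup>2) *
      (a\<^sup>2 - 2 * b * c + (2 * c\<^sup>2 - a * b) * t + (b\<^sup>2 - a * c) * t\<^sup>2)
      + (2 - t ^ 3) * (2 * c ^ 3 + b ^ 3 - 2 * a * b * c + (b\<^sup>2 * c - a * c\<^sup>2) * t)"
    by (simp add: cnorm_def power3_eq_cube power2_eq_square algebra_simps)
  also have "\<dots> = p * (s * (a\<^sup>2 - 2 * b * c + (2 * c\<^sup>2 - a * b) * t + (b\<^sup>2 - a * c) * t\<^sup>2)
      - r * (2 * c ^ 3 + b ^ 3 - 2 * a * b * c + (b\<^sup>2 * c - a * c\<^sup>2) * t))"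
    unfolding r s by (simp add: algebra_simps)
  finally show ?thesis by simp
qed

text \<open>The exponent (2p - 1)/3 is an integer, and 2 to this power is a cube root of 2, since
  2^(2(p - 1) + 1) is congruent to 2 by Fermat.\<close>

lemma cube_root_2_mod_prime:
  assumes "prime p" "p mod 3 = (2 :: nat)" "p \<noteq> 2"
  shows "\<exists>t :: int. [t ^ 3 = 2] (mod int p)"
proof -
  have "\<not> p dvd 2"
    using assms by (metis primes_dvd_imp_eq two_is_prime_nat)
  then have "[2 ^ (p - 1) = 1] (mod p)"
    using assms(1) fermat_theorem by blast
  then have "[(2 ^ (p - 1))\<^sup>2 * 2 = 1\<^sup>2 * 2] (mod p)"
    by (intro cong_mult cong_pow cong_refl)
  moreover have "(2 ^ (p - 1))\<^sup>2 * 2 = (2 ^ ((2 * p - 1) div 3) :: nat) ^ 3"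
  proof -
    have "Suc ((p - 1) * 2) = (2 * p - 1) div 3 * 3"
      using assms(2) by presburger
    then show ?thesis
      by (metis power_Suc2 power_mult)
  qed
  ultimately have "[(2 ^ ((2 * p - 1) div 3)) ^ 3 = 2] (mod p)" by simp
  then have "[int ((2 ^ ((2 * p - 1) div 3)) ^ 3) = int 2] (mod int p)"
    by (simp only: cong_int_iff)
  then have "[int (2 ^ ((2 * p - 1) div 3)) ^ 3 = 2] (mod int p)"
    by (simp only: of_nat_power of_nat_numeral)
  then show ?thesis ..
qed

text \<open>The box of nonnegative triples has more than \<open>p\<close> points, so two of them
  give the same residue; their difference is the required triple.\<close>

lemma thue_box:
  fixes p t :: int
  assumes "0 < p" "p < int ((A + 1) * (B + 1) * (C + 1))"
  obtains a b c where "(a, b, c) \<noteq> (0, 0, 0)" "\<bar>a\<bar> \<le> int A" "\<bar>b\<bar> \<le> int B" "\<bar>c\<bar> \<le> int C"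
    "p dvd a + b * t + c * t\<^sup>2"
proof -
  define D where "D = {0..int A} \<times> {0..int B} \<times> {0..int C}"
  define f where "f = (\<lambda>(a, b, c). (a + b * t + c * t\<^sup>2) mod p)"
  have "f ` D \<subseteq> {0..<p}"
    using assms(1) by (auto simp: f_def)
  then have "card (f ` D) \<le> nat p"
    using card_mono[of "{0..<p}"] by simp
  also have "nat p < card D"
    using assms by (simp add: D_def card_cartesian_product nat_less_iff algebra_simps)
  finally have "\<not> inj_on f D"
    using pigeonhole by blast
  then obtain a b c a' b' c' where *: "(a, b, c) \<in> D" "(a', b', c') \<in> D"
      "f (a, b, c) = f (a', b', c')" "(a, b, c) \<noteq> (a', b', c')"
    unfolding inj_on_def by (metis prod_cases3)
  show thesis
  proof (rule that[of "a - a'" "b - b'" "c - c'"])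
    have "p dvd (a + b * t + c * t\<^sup>2) - (a' + b' * t + c' * t\<^sup>2)"
      using *(3) by (simp add: f_def mod_eq_dvd_iff)
    then show "p dvd (a - a') + (b - b') * t + (c - c') * t\<^sup>2"
      by (simp add: algebra_simps)
  qed (use * in \<open>auto simp: D_def\<close>)
qed

text \<open>This is the norm in the variables x = a, y = \<theta>b, z = \<theta>^2 c. Twice it
  factors as x + y + z times a sum of squares, so with S = |x + y + z| it is at most S(9s^2 -
  S^2).\<close>

lemma abs_sum_cubes_bound:
  fixes x y z s :: real
  assumes "0 < s" "\<bar>x\<bar> \<le> s" "\<bar>y\<bar> \<le> s" "\<bar>z\<bar> \<le> s"
  shows "2 * \<bar>x ^ 3 + y ^ 3 + z ^ 3 - 3 * x * y * z\<bar> < 11 * s ^ 3"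
proof -
  define S where "S = \<bar>x + y + z\<bar>"
  have sq: "x\<^sup>2 \<le> s\<^sup>2" "y\<^sup>2 \<le> s\<^sup>2" "z\<^sup>2 \<le> s\<^sup>2"
    using assms by (simp_all add: abs_le_square_iff[symmetric])
  define T where "T = 3 * (x\<^sup>2 + y\<^sup>2 + z\<^sup>2) - (x + y + z)\<^sup>2"
  have "T = (x - y)\<^sup>2 + (y - z)\<^sup>2 + (z - x)\<^sup>2"
    by (simp add: T_def power2_eq_square algebra_simps)
  then have "0 \<le> T" by simp
  have "2 * \<bar>x ^ 3 + y ^ 3 + z ^ 3 - 3 * x * y * z\<bar> = \<bar>2 * (x ^ 3 + y ^ 3 + z ^ 3 - 3 * x * y * z)\<bar>"
    by (simp only: abs_mult abs_numeral)
  also have "2 * (x ^ 3 + y ^ 3 + z ^ 3 - 3 * x * y * z) = (x + y + z) * T"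
    by (simp add: T_def power3_eq_cube power2_eq_square algebra_simps)
  also have "\<bar>(x + y + z) * T\<bar> = S * T"
    using \<open>0 \<le> T\<close> by (simp add: S_def abs_mult)
  also have "S * T = S * (3 * (x\<^sup>2 + y\<^sup>2 + z\<^sup>2) - S\<^sup>2)"
    by (simp add: T_def S_def)
  also have "\<dots> \<le> S * (9 * s\<^sup>2 - S\<^sup>2)"
    using sq by (intro mult_left_mono) (auto simp: S_def)
  also have "\<dots> < 11 * s ^ 3"
  proof -
    \<comment> \<open>The maximum of S(9s^2 - S^2) is 6 sqrt 3 s^3 < 11 s^3, at S = sqrt 3 s; the
      square is centred at the rational approximation 7/4 of sqrt 3.\<close>
    have "0 \<le> (S - 7 / 4 * s)\<^sup>2 * (S + 7 / 2 * s)" "0 \<le> 3 / 16 * (S * s\<^sup>2)"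
      using assms by (auto simp: S_def)
    moreover have "0 < (9 / 32) * s ^ 3"
      using assms by simp
    moreover have "11 * s ^ 3 - S * (9 * s\<^sup>2 - S\<^sup>2)
        = (S - 7 / 4 * s)\<^sup>2 * (S + 7 / 2 * s) + 3 / 16 * (S * s\<^sup>2) + (9 / 32) * s ^ 3"
      by (simp add: power3_eq_cube power2_eq_square field_simps)
    ultimately show ?thesis by linarith
  qed
  finally show ?thesis .
qed

text \<open>With s^3 = 2p, the box with sides s, s/\<theta>, s/\<theta>^2 has volume p, so it
  contains more than p integer points. In it a, \<theta>b and \<theta>^2 c are all bounded by s, so
  twice the norm is below 11 s^3 = 22p.\<close>

lemma cnorm_small_multiple:
  fixes p t :: int
  assumes "0 < p" "[t ^ 3 = 2] (mod p)"
  obtains a b c k where "cnorm a b c = k * p" "0 < k" "k \<le> 10"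
proof -
  define \<theta> where "\<theta> = root 3 2"
  define s where "s = root 3 (2 * p)"
  have \<theta>: "\<theta> > 0" "\<theta> ^ 3 = 2" and s: "s > 0" "s ^ 3 = 2 * p"
    using assms(1) by (simp_all add: \<theta>_def s_def)
  define A where "A = nat \<lfloor>s\<rfloor>"
  define B where "B = nat \<lfloor>s / \<theta>\<rfloor>"
  define C where "C = nat \<lfloor>s / \<theta>\<^sup>2\<rfloor>"
  have lt: "s < A + 1" "s / \<theta> < B + 1" "s / \<theta>\<^sup>2 < C + 1"
    using s(1) \<theta>(1) by (simp_all add: A_def B_def C_def) linarith+
  have le: "real A \<le> s" "real B \<le> s / \<theta>" "real C \<le> s / \<theta>\<^sup>2"
    using s(1) \<theta>(1) by (simp_all add: A_def B_def C_def)
  have "real_of_int p = s * (s / \<theta>) * (s / \<theta>\<^sup>2)"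
    using s \<theta> by (simp add: power3_eq_cube power2_eq_square mult.assoc)
  also have "\<dots> < real (A + 1) * real (B + 1) * real (C + 1)"
    using lt s(1) \<theta>(1) by (intro mult_strict_mono mult_pos_pos divide_pos_pos) auto
  also have "\<dots> = real ((A + 1) * (B + 1) * (C + 1))"
    by (simp only: of_nat_mult)
  finally have "p < int ((A + 1) * (B + 1) * (C + 1))"
    by (metis of_int_less_iff of_int_of_nat_eq)
  with assms(1) obtain a b c where abc: "(a, b, c) \<noteq> (0, 0, 0)" "\<bar>a\<bar> \<le> int A" "\<bar>b\<bar> \<le> int B"
      "\<bar>c\<bar> \<le> int C" "p dvd a + b * t + c * t\<^sup>2"
    by (rule thue_box)
  obtain k where k: "cnorm a b c = k * p"
    using dvd_cnorm[OF assms(2) abc(5)] by (metis dvdE mult.commute)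
  have "k \<noteq> 0"
    using abc(1) cnorm_eq_0D[of a b c] k by auto
  have "\<bar>real_of_int a\<bar> \<le> s" "\<bar>\<theta> * b\<bar> \<le> s" "\<bar>\<theta>\<^sup>2 * c\<bar> \<le> s"
  proof -
    have "\<bar>real_of_int a\<bar> \<le> A" "\<bar>real_of_int b\<bar> \<le> B" "\<bar>real_of_int c\<bar> \<le> C"
      using abc(2-4) by linarith+
    then have "\<bar>real_of_int a\<bar> \<le> s" "\<bar>real_of_int b\<bar> \<le> s / \<theta>" "\<bar>real_of_int c\<bar> \<le> s / \<theta>\<^sup>2"
      using le by linarith+
    then show "\<bar>real_of_int a\<bar> \<le> s" "\<bar>\<theta> * b\<bar> \<le> s" "\<bar>\<theta>\<^sup>2 * c\<bar> \<le> s"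
      using \<theta>(1) by (simp_all add: abs_mult field_simps)
  qed
  from abs_sum_cubes_bound[OF s(1) this]
  have "2 * \<bar>real_of_int a ^ 3 + (\<theta> * b) ^ 3 + (\<theta>\<^sup>2 * c) ^ 3 - 3 * a * (\<theta> * b) * (\<theta>\<^sup>2 * c)\<bar> < 22 * p"
    by (simp add: s(2))
  also have "real_of_int a ^ 3 + (\<theta> * b) ^ 3 + (\<theta>\<^sup>2 * c) ^ 3 - 3 * a * (\<theta> * b) * (\<theta>\<^sup>2 * c)
      = real_of_int a ^ 3 + \<theta> ^ 3 * b ^ 3 + (\<theta> ^ 3)\<^sup>2 * c ^ 3 - 3 * \<theta> ^ 3 * a * b * c"
    by (simp add: power_mult_distrib power3_eq_cube power2_eq_square algebra_simps)
  also have "\<dots> = real_of_int (cnorm a b c)"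
    by (simp add: \<theta>(2) cnorm_def)
  finally have "\<bar>real_of_int (cnorm a b c)\<bar> < real_of_int (11 * p)"
    by simp
  then have "\<bar>k * p\<bar> < 11 * p"
    unfolding k by linarith
  then have "\<bar>k\<bar> * p < 11 * p"
    using assms(1) by (simp add: abs_mult)
  then have "\<bar>k\<bar> < 11"
    using assms(1) by (simp add: mult_less_cancel_right)
  show thesis
  proof (cases "k > 0")
    case True
    then show ?thesis using that[OF k] \<open>\<bar>k\<bar> < 11\<close> by simp
  next
    case False
    have "cnorm (-a) (-b) (-c) = (-k) * p"
      by (simp add: cnorm_minus k)
    then show ?thesis using that[of "-a" "-b" "-c" "-k"] \<open>\<bar>k\<bar> < 11\<close> \<open>k \<noteq> 0\<close> False by simp
  qed
qed

lemma prime_2_mod_3_represented: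
  assumes "prime p" "p mod 3 = (2 :: nat)"
  shows "\<exists>x y z. int p = cubic_form x y z"
proof (cases "p = 2 \<or> p = 5")
  case True
  \<comment> \<open>2 escapes the parity argument and 5 the division by 5, so both get explicit
    witnesses.\<close>
  have "cubic_form 0 0 1 = 2" "cubic_form 1 (-3) 0 = 5"
    by (simp_all add: cubic_form_def)
  with True show ?thesis by (metis of_nat_numeral)
next
  case False
  then obtain t :: int where t: "[t ^ 3 = 2] (mod int p)"
    using cube_root_2_mod_prime assms by blast
  have "prime (int p)" "int p \<notin> {2, 3, 5, 7}"
    using assms False by auto
  then obtain a b c where "cnorm a b c = int p"
    using cnorm_small_multiple[OF _ t] cnorm_divide_small by (metis prime_gt_0_int)
  moreover have "odd (int p)"
    using assms False by (metis even_of_nat primes_dvd_imp_eq two_is_prime_nat)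
  ultimately show ?thesis
    using cubic_form_represents_odd_cnorm[of a b c] by metis
qed

subsection \<open>Chebyshev estimates modulo 3\<close>

text \<open>Expands each logarithm as the sum of \<open>mangoldt\<close> over divisors and swaps the
  sums. Serves both factorials and products over residue classes.\<close>

lemma sum_ln_conv_mangoldt:
  fixes f :: "'a \<Rightarrow> nat"
  assumes "finite I" "\<And>i. i \<in> I \<Longrightarrow> f i \<in> {1..N}"
  shows "(\<Sum>i\<in>I. ln (real (f i))) = (\<Sum>d\<in>{1..N}. mangoldt d * real (card {i \<in> I. d dvd f i}))"
proof -
  have "(\<Sum>i\<in>I. ln (real (f i))) = (\<Sum>i\<in>I. \<Sum>d\<in>{1..N}. if d dvd f i then mangoldt d else 0)"
  proof (rule sum.cong[OF refl])
    fix i assume "i \<in> I"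
    with assms(2) have i: "f i \<in> {1..N}" by blast
    then have "ln (real (f i)) = (\<Sum>d | d dvd f i. mangoldt d)"
      using mangoldt_sum[of "f i", where ?'a = real] by simp
    also have "{d. d dvd f i} = {d \<in> {1..N}. d dvd f i}"
      using i by (auto dest: dvd_imp_le intro: Suc_leI dvd_pos_nat)
    also have "(\<Sum>d\<in>\<dots>. mangoldt d) = (\<Sum>d\<in>{1..N}. if d dvd f i then mangoldt d else (0 :: real))"
      by (rule sum.inter_filter) simp
    finally show "ln (real (f i)) = (\<Sum>d\<in>{1..N}. if d dvd f i then mangoldt d else 0)" .
  qed
  also have "\<dots> = (\<Sum>d\<in>{1..N}. \<Sum>i\<in>I. if d dvd f i then mangoldt d else 0)"
    by (rule sum.swap)
  also have "\<dots> = (\<Sum>d\<in>{1..N}. mangoldt d * real (card {i \<in> I. d dvd f i}))"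
    by (rule sum.cong[OF refl]) (simp add: sum.inter_filter[OF assms(1), symmetric] mult.commute)
  finally show ?thesis .
qed

section \<open>Legendre's formula and central binomial coefficients\<close>

lemma card_multiples_atMost:
  assumes "d > (0 :: nat)"
  shows "card {i \<in> {1..n}. d dvd i} = n div d"
proof -
  have "{i \<in> {1..n}. d dvd i} = (\<lambda>k. d * k) ` {1..n div d}"
    using assms by (auto simp: image_iff less_eq_div_iff_mult_less_eq mult.commute elim!: dvdE)
  then show ?thesis
    using assms by (simp add: card_image inj_on_def)
qed

text \<open>Legendre's formula. Terms with \<open>d > n\<close> vanish, so the free bound
  \<open>N\<close> lets several factorials share one range.\<close>

lemma ln_fact_conv_mangoldt:
  assumes "n \<le> N"
  shows "ln (fact n :: real) = (\<Sum>d\<in>{1..N}. mangoldt d * real (n div d))"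
proof -
  have "ln (fact n :: real) = (\<Sum>i\<in>{1..n}. ln (real i))"
    by (subst ln_prod[symmetric]) (auto simp: fact_prod)
  also have "\<dots> = (\<Sum>d\<in>{1..N}. mangoldt d * real (card {i \<in> {1..n}. d dvd i}))"
    using assms by (intro sum_ln_conv_mangoldt) auto
  also have "\<dots> = (\<Sum>d\<in>{1..N}. mangoldt d * real (n div d))"
  proof (rule sum.cong[OF refl])
    fix d assume "d \<in> {1..N}"
    then show "mangoldt d * real (card {i \<in> {1..n}. d dvd i}) = mangoldt d * real (n div d)"
      by (subst card_multiples_atMost) auto
  qed
  finally show ?thesis .
qed

definition psi :: "nat \<Rightarrow> real" where
  "psi n = (\<Sum>d\<in>{1..n}. mangoldt d)"

lemma psi_diff: "m \<le> n \<Longrightarrow> psi n - psi m = (\<Sum>d\<in>{m<..n}. mangoldt d)"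
  unfolding psi_def by (subst sum_diff[symmetric]) (auto intro!: sum.cong)

lemma ln_central_binomial_conv_mangoldt:
  "ln (real (2 * n choose n)) = (\<Sum>d\<in>{1..2 * n}. mangoldt d * real (2 * n div d - 2 * (n div d)))"
proof -
  have "real (2 * n choose n) = fact (2 * n) / (fact n * fact n)"
    using binomial_fact[of n "2 * n", where ?'a = real] by simp
  then have "ln (real (2 * n choose n)) = ln (fact (2 * n)) - 2 * ln (fact n)"
    by (simp add: ln_div ln_mult)
  also have "\<dots> = (\<Sum>d\<in>{1..2 * n}. mangoldt d * (real (2 * n div d) - 2 * real (n div d)))"
    by (simp add: ln_fact_conv_mangoldt[of _ "2 * n"] sum_distrib_left sum_subtractf algebra_simps)
  \<comment> \<open>The truncated subtraction is exact because
    \<open>2 * (n div d) \<le> 2 * n div d\<close>.\<close>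
  also have "\<dots> = (\<Sum>d\<in>{1..2 * n}. mangoldt d * real (2 * n div d - 2 * (n div d)))"
    by (intro sum.cong) (simp_all add: of_nat_diff div_mult2_eq' less_eq_div_iff_mult_less_eq)
  finally show ?thesis .
qed

text \<open>Every \<open>d\<close> in (n, 2n] has coefficient at least 1 in the expansion, and no
  coefficient is negative.\<close>

lemma psi_double_diff_le_ln_binomial: "psi (2 * n) - psi n \<le> ln (real (2 * n choose n))"
proof -
  have "psi (2 * n) - psi n = (\<Sum>d\<in>{n<..2 * n}. mangoldt d)"
    by (simp add: psi_diff)
  also have "\<dots> \<le> (\<Sum>d\<in>{n<..2 * n}. mangoldt d * real (2 * n div d - 2 * (n div d)))"
  proof (rule sum_mono)
    fix d assume d: "d \<in> {n<..2 * n}"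
    then have "n div d = 0" "1 \<le> 2 * n div d"
      by (simp_all add: Suc_le_eq div_greater_zero_iff)
    then show "mangoldt d \<le> mangoldt d * real (2 * n div d - 2 * (n div d))"
      using mult_left_mono[OF _ mangoldt_nonneg, of 1 "real (2 * n div d)" d] by simp
  qed
  also have "\<dots> \<le> (\<Sum>d\<in>{1..2 * n}. mangoldt d * real (2 * n div d - 2 * (n div d)))"
    by (intro sum_mono2) (auto simp: mangoldt_nonneg)
  finally show ?thesis
    by (simp add: ln_central_binomial_conv_mangoldt)
qed

text \<open>All coefficients are at most 1, and they vanish for 2n/3 < d \<le> n, where
  \<open>n div d = 1\<close> and \<open>2 * n div d = 2\<close>.\<close>

lemma ln_binomial_le_psi:
  "ln (real (2 * n choose n)) \<le> psi (2 * n) - psi n + psi (2 * n div 3)"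
proof -
  have "ln (real (2 * n choose n))
      \<le> (\<Sum>d\<in>{1..2 * n}. (if n < d then mangoldt d else 0) + (if d \<le> 2 * n div 3 then mangoldt d else 0))"
    unfolding ln_central_binomial_conv_mangoldt
  proof (rule sum_mono)
    fix d assume d: "d \<in> {1..2 * n}"
    define q where "q = n div d"
    have q: "d * q \<le> n" "n < d * q + d"
      using d using dividend_less_times_div[of d n] by (simp_all add: q_def)
    have "2 * n < d * (2 * q + 2)"
      using q(2) by (simp add: algebra_simps)
    then have "2 * n div d < 2 * q + 2"
      using d by (simp add: div_less_iff_less_mult mult.commute)
    then have 1: "2 * n div d - 2 * q \<le> 1" by simp
    have 0: "2 * n div d - 2 * q = 0" if "2 * n div 3 < d" "d \<le> n"
    proof -
      have "1 \<le> q"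
        using that d by (simp add: q_def Suc_le_eq div_greater_zero_iff)
      moreover have "2 * n div d < 3"
        using that d by (simp add: div_less_iff_less_mult mult.commute)
      ultimately show ?thesis by simp
    qed
    have "mangoldt d * real (2 * n div d - 2 * q) \<le> mangoldt d * 1"
      using 1 by (intro mult_left_mono mangoldt_nonneg) simp
    then show "mangoldt d * real (2 * n div d - 2 * (n div d))
        \<le> (if n < d then mangoldt d else 0) + (if d \<le> 2 * n div 3 then mangoldt d else 0)"
      using 0 mangoldt_nonneg[of d] by (auto simp: q_def)
  qed
  also have "\<dots> = (\<Sum>d\<in>{d \<in> {1..2 * n}. n < d}. mangoldt d) + (\<Sum>d\<in>{d \<in> {1..2 * n}. d \<le> 2 * n div 3}. mangoldt d)"
    by (simp only: sum.distrib sum.inter_filter finite_atLeastAtMost)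
  also have "{d \<in> {1..2 * n}. n < d} = {n<..2 * n}" by auto
  also have "{d \<in> {1..2 * n}. d \<le> 2 * n div 3} = {1..2 * n div 3}" by auto
  finally show ?thesis
    by (simp add: psi_diff[of n "2 * n"]) (simp add: psi_def)
qed

section \<open>Chebyshev bounds for \<open>psi\<close>\<close>

lemma ln_le_2_sqrt: "x > 0 \<Longrightarrow> ln x \<le> 2 * sqrt x"
  using ln_le_minus_one[of "sqrt x"] by (simp add: ln_sqrt)

text \<open>Induction by halving: the binomial bound gives \<open>ln 4 * m\<close> for the step from
  \<open>m\<close> to \<open>2 * m\<close>, and an odd \<open>n\<close> adds at most
  \<open>ln n\<close>.\<close>

lemma psi_upper: "psi n \<le> ln 4 * n + 7 * sqrt n"
proof (induction n rule: less_induct)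
  case (less n)
  show ?case
  proof (cases "n = 0")
    case False
    define m where "m = n div 2"
    have m: "m < n" "n = 2 * m \<or> n = Suc (2 * m)" "2 * m \<le> n"
      using False by (auto simp: m_def)
    have "psi n \<le> psi (2 * m) + ln n"
      using m(2)
    proof
      assume "n = 2 * m"
      then show ?thesis using False by simp
    next
      assume *: "n = Suc (2 * m)"
      have "psi n = psi (2 * m) + mangoldt n"
        by (simp add: psi_def *)
      then show ?thesis using mangoldt_le[of n] False by simp
    qed
    moreover have "psi (2 * m) \<le> psi m + ln 4 * m"
    proof -
      have "real (2 * m choose m) \<le> real (2 ^ (2 * m))"
        by (intro of_nat_mono binomial_le_pow2)
      then have "ln (real (2 * m choose m)) \<le> ln (real (2 ^ (2 * m)))"
        by (subst ln_le_cancel_iff) auto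
      also have "\<dots> = ln 4 * m"
        by (simp add: power_mult ln_realpow)
      finally show ?thesis using psi_double_diff_le_ln_binomial[of m] by simp
    qed
    moreover have "psi m \<le> ln 4 * m + 7 * sqrt m"
      by (rule less.IH) fact
    moreover have "ln (real n) \<le> 2 * sqrt n"
      using False by (intro ln_le_2_sqrt) simp
    \<comment> \<open>Halving turns the error 7 sqrt n into at most 5 sqrt n, as 49 < 2 * 25; this
      leaves 2 sqrt n to absorb \<open>ln n\<close>.\<close>
    moreover have "7 * sqrt m \<le> 5 * sqrt n"
    proof -
      have "sqrt (7\<^sup>2 * m) \<le> sqrt (5\<^sup>2 * n)"
        using m(3) by (intro real_sqrt_le_mono) simp
      then show ?thesis by (simp add: real_sqrt_mult)
    qed
    moreover have "ln 4 * real m + ln 4 * real m \<le> ln 4 * real n"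
      using m(3) mult_left_mono[of "2 * real m" n "ln 4"] by simp
    ultimately show ?thesis by linarith
  qed (simp add: psi_def)
qed

text \<open>Since C(2n, n) \<ge> 4^n/(2n), removing \<open>psi (2 * n div 3)\<close> leaves the main
  term n ln 4 / 3 \<ge> 4n/9. The errors total 10 sqrt n \<le> n/9 because 8100 = 90^2.\<close>

lemma psi_double_diff_lower:
  assumes "n \<ge> 8100"
  shows "psi (2 * n) - psi n \<ge> n / 3"
proof -
  have sq: "sqrt n * sqrt n = n" "sqrt n \<ge> 90"
    using assms by (auto intro: real_le_rsqrt)
  have "ln 4 * n - ln (2 * real n) = ln (4 ^ n / (2 * real n))"
    using assms by (simp add: ln_div ln_realpow)
  also have "\<dots> \<le> ln (real (2 * n choose n))"
    using assms central_binomial_lower_bound[of n] by (subst ln_le_cancel_iff) auto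
  also have "\<dots> \<le> psi (2 * n) - psi n + psi (2 * n div 3)"
    by (rule ln_binomial_le_psi)
  finally have "psi (2 * n) - psi n \<ge> ln 4 * n - ln (2 * real n) - psi (2 * n div 3)"
    by simp
  moreover have "ln (2 * real n) \<le> 3 * sqrt n"
  proof -
    have "ln (2 * real n) \<le> 2 * sqrt (2 * real n)"
      using assms by (intro ln_le_2_sqrt) simp
    also have "2 * sqrt (2 * real n) = sqrt (8 * n)"
      using real_sqrt_mult[of 4 "2 * n"] by simp
    also have "\<dots> \<le> sqrt (9 * n)"
      by (intro real_sqrt_le_mono) simp
    also have "\<dots> = 3 * sqrt n"
      by (simp add: real_sqrt_mult)
    finally show ?thesis .
  qed
  moreover have "psi (2 * n div 3) \<le> ln 4 * (2 * n / 3) + 7 * sqrt n"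
  proof -
    have "real (2 * n div 3) \<le> 2 * n / 3"
      by linarith
    then have "ln 4 * real (2 * n div 3) \<le> ln 4 * (2 * n / 3)"
        "7 * sqrt (real (2 * n div 3)) \<le> 7 * sqrt n"
      by (auto intro!: mult_left_mono)
    then show ?thesis
      using psi_upper[of "2 * n div 3"] by linarith
  qed
  moreover have "4 / 3 * real n \<le> ln 4 * n"
  proof -
    have "ln (4 :: real) = 2 * ln 2"
      using ln_realpow[of 2 2] by simp
    then show ?thesis
      using ln2_ge_two_thirds by (intro mult_right_mono) auto
  qed
  moreover have "90 * sqrt n \<le> n"
    using mult_right_mono[OF sq(2), of "sqrt n"] sq(1) by simp
  ultimately show ?thesis by simp
qed

text \<open>Grouping by the underlying prime p, at most ln N / ln p exponents occur, each of weight
  ln p, so every prime contributes at most ln N.\<close>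

lemma sum_mangoldt_le_card_mult_ln:
  assumes "N > 0" "D \<subseteq> {1..N}" "finite Q"
    and "\<And>d. d \<in> D \<Longrightarrow> primepow d \<Longrightarrow> aprimedivisor d \<in> Q"
  shows "(\<Sum>d\<in>D. mangoldt d) \<le> real (card Q) * ln N"
proof -
  define D' where "D' = {d \<in> D. primepow d}"
  have fin: "finite D" "finite D'"
    using assms(2) by (auto simp: D'_def intro: finite_subset)
  have "(\<Sum>d\<in>D. mangoldt d) = (\<Sum>d\<in>D'. ln (real (aprimedivisor d)))"
    unfolding D'_def sum.inter_filter[OF fin(1)] by (intro sum.cong) (auto simp: mangoldt_def)
  also have "\<dots> = (\<Sum>p\<in>Q. \<Sum>d\<in>{d \<in> D'. aprimedivisor d = p}. ln (real (aprimedivisor d)))"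
    using assms(3,4) fin by (intro sum.group[symmetric]) (auto simp: D'_def)
  also have "\<dots> \<le> (\<Sum>p\<in>Q. ln N)"
  proof (rule sum_mono)
    fix p assume "p \<in> Q"
    show "(\<Sum>d\<in>{d \<in> D'. aprimedivisor d = p}. ln (real (aprimedivisor d))) \<le> ln N"
    proof (cases "prime p")
      case True
      then have p: "p > 1" by (rule prime_gt_1_nat)
      define K where "K = nat \<lfloor>ln N / ln p\<rfloor>"
      have "{d \<in> D'. aprimedivisor d = p} \<subseteq> (\<lambda>k. p ^ k) ` {1..K}"
      proof
        fix d assume d: "d \<in> {d \<in> D'. aprimedivisor d = p}"
        then obtain q k where qk: "prime q" "k > 0" "d = q ^ k"
          by (auto simp: D'_def primepow_def)
        with d have "q = p"
          by (simp add: aprimedivisor_prime_power)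
        have "d > 0" "d \<le> N"
          using d assms(2) by (auto simp: D'_def)
        then have "ln (real d) \<le> ln N"
          using assms(1) by simp
        then have "k \<le> ln N / ln p"
          using p by (simp add: qk \<open>q = p\<close> ln_realpow field_simps)
        then have "k \<le> K"
          by (simp add: K_def le_nat_floor)
        then show "d \<in> (\<lambda>k. p ^ k) ` {1..K}"
          using qk \<open>q = p\<close> by auto
      qed
      then have "card {d \<in> D'. aprimedivisor d = p} \<le> K"
        using surj_card_le[of "{1..K}"] by simp
      then have "real (card {d \<in> D'. aprimedivisor d = p}) \<le> K" by simp
      also have "\<dots> \<le> ln N / ln p"
        using p assms(1) by (simp add: K_def)
      finally show ?thesis
        using p by (simp add: field_simps)
    next
      case False
      then have empty: "{d \<in> D'. aprimedivisor d = p} = {}"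
        by (auto simp: D'_def primepow_def aprimedivisor_prime_power)
      show ?thesis
        unfolding empty using assms(1) by simp
    qed
  qed
  finally show ?thesis by simp
qed

text \<open>If \<open>d \<equiv> 1 (mod 3)\<close>, subtracting \<open>d\<close> maps the multiples \<open>3k + 2\<close> of \<open>d\<close> injectively to multiples
  \<open>3k' + 1\<close>; if \<open>d \<equiv> 2\<close>, subtracting \<open>2d\<close> does so for all multiples except \<open>d\<close> itself.\<close>

lemma sum_mangoldt_1_mod_3_le_2_mod_3:
  "(\<Sum>d | 3 * n < 2 * d \<and> d \<le> 3 * n \<and> d mod 3 = 1. mangoldt d :: real)
    \<le> (\<Sum>d | d \<le> 3 * n \<and> d mod 3 = 2. mangoldt d)"
proof -
  define N1 where "N1 d = {k \<in> {..<n}. d dvd 3 * k + 1}" for d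
  define N2 where "N2 d = {k \<in> {..<n}. d dvd 3 * k + 2}" for d
  have fin: "finite (N1 d)" "finite (N2 d)" for d
    by (simp_all add: N1_def N2_def)
  have N0: "N1 d = {}" "N2 d = {}" if "d mod 3 = 0" for d
  proof -
    have "3 dvd d" using that by auto
    then have "3 dvd 3 * k + 1 \<or> 3 dvd 3 * k + 2" if "d dvd 3 * k + 1 \<or> d dvd 3 * k + 2" for k
      using that by (auto intro: dvd_trans)
    moreover have "\<not> 3 dvd 3 * k + 1" "\<not> 3 dvd 3 * k + 2" for k :: nat
      by presburger+
    ultimately show "N1 d = {}" "N2 d = {}"
      by (auto simp: N1_def N2_def)
  qed
  have le1: "card (N2 d) \<le> card (N1 d)" if "d mod 3 = 1" for d
  proof -
    define e where "e = d div 3"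
    have d: "d = 3 * e + 1" using that by (simp add: e_def) presburger
    have ge: "e \<le> k \<and> k - e \<in> N1 d" if "k \<in> N2 d" for k
    proof -
      have "d dvd 3 * k + 2"
        using that by (simp add: N2_def)
      then obtain j where j: "3 * k + 2 = d * j" ..
      have "d \<le> 3 * k + 2"
        using \<open>d dvd 3 * k + 2\<close> by (rule dvd_imp_le) simp
      then have "e \<le> k"
        using d by linarith
      moreover have "3 * (k - e) + 1 = (3 * k + 2) - d"
        using \<open>e \<le> k\<close> by (simp add: d)
      moreover have "d dvd (3 * k + 2) - d"
        using j by (simp add: dvd_diff_nat)
      ultimately have "d dvd 3 * (k - e) + 1" by simp
      moreover have "k - e < n"
        using that by (simp add: N2_def less_imp_diff_less)
      ultimately show ?thesis
        using \<open>e \<le> k\<close> by (simp add: N1_def)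
    qed
    have "inj_on (\<lambda>k. k - e) (N2 d)"
      by (rule inj_onI) (metis ge le_add_diff_inverse)
    then show ?thesis
      using ge fin by (intro card_inj_on_le[of "\<lambda>k. k - e"]) auto
  qed
  \<comment> \<open>Here every 3k + 2 with k < n lies below 2d and could only equal d, which is in
    the other class; but d itself is some 3e + 1 with e < n.\<close>
  have lt1: "card (N2 d) + 1 \<le> card (N1 d)" if "d mod 3 = 1" "3 * n < 2 * d" "d \<le> 3 * n" for d
  proof -
    have "k \<notin> N2 d" for k
    proof
      assume "k \<in> N2 d"
      then have "d dvd 3 * k + 2" "k < n"
        by (simp_all add: N2_def)
      then obtain j where j: "3 * k + 2 = d * j" "k < n"
        by (auto elim: dvdE)
      have "d * j < d * 2"
        using j that by linarith
      then have "j < 2" by simp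
      then have "j = 0 \<or> j = 1" by auto
      then show False
        using j(1) that(1) by presburger
    qed
    then have "N2 d = {}" by auto
    moreover define e where "e = d div 3"
    have "d = 3 * e + 1"
      using div_mult_mod_eq[of d 3] that(1) by (simp add: e_def)
    then have "e \<in> N1 d"
      using that(3) by (simp add: N1_def)
    ultimately show ?thesis
      using fin(1)[of d] by (auto simp: card_gt_0_iff Suc_le_eq)
  qed
  have le2: "card (N2 d) \<le> card (N1 d) + 1" if "d mod 3 = 2" for d
  proof -
    define e where "e = d div 3"
    have d: "d = 3 * e + 2" using that by (simp add: e_def) presburger
    have ge: "2 * e + 1 \<le> k \<and> k - (2 * e + 1) \<in> N1 d" if "k \<in> N2 d - {e}" for k
    proof -
      have "d dvd 3 * k + 2"
        using that by (simp add: N2_def)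
      then obtain j where j: "3 * k + 2 = d * j" ..
      have "j \<noteq> 0"
      proof
        assume "j = 0"
        with j show False by simp
      qed
      moreover have "j \<noteq> 1"
      proof
        assume "j = 1"
        with j d that show False by simp
      qed
      moreover have "j \<noteq> 2"
      proof
        assume "j = 2"
        with j d have "3 * k + 2 = 6 * e + 4" by simp
        then show False by presburger
      qed
      ultimately have "d * 2 \<le> d * j"
        by (intro mult_left_mono) auto
      then have "2 * e + 1 \<le> k"
        using j by (simp add: d)
      moreover from this have "3 * (k - (2 * e + 1)) + 1 = (3 * k + 2) - 2 * d"
        by (simp add: d)
      moreover have "d dvd (3 * k + 2) - 2 * d"
        using j by (simp add: dvd_diff_nat)
      ultimately have "2 * e + 1 \<le> k" "d dvd 3 * (k - (2 * e + 1)) + 1" by simp_all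
      moreover have "k - (2 * e + 1) < n"
        using that by (simp add: N2_def less_imp_diff_less)
      ultimately show ?thesis
        by (simp add: N1_def)
    qed
    have "inj_on (\<lambda>k. k - (2 * e + 1)) (N2 d - {e})"
      by (rule inj_onI) (metis ge le_add_diff_inverse)
    then have "card (N2 d - {e}) \<le> card (N1 d)"
      using ge fin by (intro card_inj_on_le[of "\<lambda>k. k - (2 * e + 1)"]) auto
    then show ?thesis
      using fin(2)[of d] by (simp add: card_Diff_singleton_if split: if_splits)
  qed
  have "0 \<le> (\<Sum>k<n. ln (real (3 * k + 2))) - (\<Sum>k<n. ln (real (3 * k + 1)))"
    by (simp add: sum_mono)
  also have "\<dots> = (\<Sum>d\<in>{1..3 * n}. mangoldt d * (real (card (N2 d)) - real (card (N1 d))))"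
    using sum_ln_conv_mangoldt[of "{..<n}" "\<lambda>k. 3 * k + 1" "3 * n"]
      sum_ln_conv_mangoldt[of "{..<n}" "\<lambda>k. 3 * k + 2" "3 * n"]
    by (simp add: N1_def N2_def sum_subtractf algebra_simps)
  also have "\<dots> \<le> (\<Sum>d\<in>{1..3 * n}. (if d mod 3 = 2 then mangoldt d else 0)
      - (if 3 * n < 2 * d \<and> d mod 3 = 1 then mangoldt d else 0))"
  proof (rule sum_mono)
    fix d assume d: "d \<in> {1..3 * n}"
    \<comment> \<open>\<open>c\<close> is the coefficient of \<open>mangoldt d\<close> in the
      logarithm of the quotient of the two products; \<open>b\<close> bounds it by 1 on the class 2,
      by -1 on the upper half of the class 1, and by 0 elsewhere.\<close>
    define c where "c = real (card (N2 d)) - real (card (N1 d))"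
    define b :: real where "b = (if d mod 3 = 2 then 1 else 0) - (if 3 * n < 2 * d \<and> d mod 3 = 1 then 1 else 0)"
    have "d mod 3 = 0 \<or> d mod 3 = 1 \<or> d mod 3 = 2" by auto
    then have "c \<le> b"
      using le1[of d] lt1[of d] le2[of d] N0[of d] d by (auto simp: c_def b_def)
    then have "mangoldt d * c \<le> mangoldt d * b"
      by (intro mult_left_mono mangoldt_nonneg)
    then show "mangoldt d * (real (card (N2 d)) - real (card (N1 d)))
        \<le> (if d mod 3 = 2 then mangoldt d else 0) - (if 3 * n < 2 * d \<and> d mod 3 = 1 then mangoldt d else 0)"
      unfolding c_def[symmetric] by (auto simp: b_def split: if_splits)
  qed
  also have "\<dots> = (\<Sum>d\<in>{d \<in> {1..3 * n}. d mod 3 = 2}. mangoldt d)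
      - (\<Sum>d\<in>{d \<in> {1..3 * n}. 3 * n < 2 * d \<and> d mod 3 = 1}. mangoldt d)"
    unfolding sum_subtractf by (simp only: sum.inter_filter finite_atLeastAtMost)
  also have "{d \<in> {1..3 * n}. d mod 3 = 2} = {d. d \<le> 3 * n \<and> d mod 3 = 2}"
    by (auto simp: Suc_le_eq intro: Nat.gr0I)
  also have "{d \<in> {1..3 * n}. 3 * n < 2 * d \<and> d mod 3 = 1} = {d. 3 * n < 2 * d \<and> d \<le> 3 * n \<and> d mod 3 = 1}"
    by (auto simp: Suc_le_eq intro: Nat.gr0I)
  finally show ?thesis by simp
qed

section \<open>Counting primes in the class 2 modulo 3\<close>

definition primes_2_mod_3 :: "nat \<Rightarrow> nat set" where
  "primes_2_mod_3 n = {p. prime p \<and> p mod 3 = 2 \<and> p \<le> n}"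

lemma finite_primes_2_mod_3 [simp]: "finite (primes_2_mod_3 n)"
  by (rule finite_subset[of _ "{..n}"]) (auto simp: primes_2_mod_3_def)

lemma prime_power_mod_3_eq_2:
  assumes "prime p" "p ^ k mod 3 = (2 :: nat)"
  shows "p mod 3 = 2"
proof (rule ccontr)
  assume "p mod 3 \<noteq> 2"
  then have "p mod 3 = 0 \<or> p mod 3 = 1" by auto
  then have "(p mod 3) ^ k mod 3 \<noteq> 2"
    by (cases k) auto
  then show False
    using assms(2) by (simp add: power_mod)
qed

text \<open>The weight on (3m, 6m] is at least m and is split by residue. The class 0 holds only
  powers of 3, giving the summand 1; the class 1 is dominated by the class 2 up to 6m, giving the
  factor 2.\<close>

lemma card_primes_2_mod_3_lower:
  assumes "m \<ge> 2700"
  shows "m \<le> (2 * real (card (primes_2_mod_3 (6 * m))) + 1) * ln (real (6 * m))"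
proof -
  have "real m \<le> psi (2 * (3 * m)) - psi (3 * m)"
    using psi_double_diff_lower[of "3 * m"] assms by simp
  also have "\<dots> = (\<Sum>d\<in>{3 * m<..6 * m}. mangoldt d)"
    by (simp add: psi_diff)
  also have "{3 * m<..6 * m} = {d. 3 * m < d \<and> d \<le> 6 * m \<and> 3 dvd d}
      \<union> ({d. 3 * m < d \<and> d \<le> 6 * m \<and> d mod 3 = 1} \<union> {d. 3 * m < d \<and> d \<le> 6 * m \<and> d mod 3 = 2})"
    by auto presburger
  also have "(\<Sum>d\<in>\<dots>. mangoldt d :: real) = (\<Sum>d | 3 * m < d \<and> d \<le> 6 * m \<and> 3 dvd d. mangoldt d)
      + ((\<Sum>d | 3 * m < d \<and> d \<le> 6 * m \<and> d mod 3 = 1. mangoldt d)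
      + (\<Sum>d | 3 * m < d \<and> d \<le> 6 * m \<and> d mod 3 = 2. mangoldt d))"
    by (subst sum.union_disjoint; (subst sum.union_disjoint)?) auto
  also have "(\<Sum>d | 3 * m < d \<and> d \<le> 6 * m \<and> 3 dvd d. mangoldt d) \<le> real (card {3 :: nat}) * ln (real (6 * m))"
  proof (rule sum_mangoldt_le_card_mult_ln)
    fix d :: nat assume "d \<in> {d. 3 * m < d \<and> d \<le> 6 * m \<and> 3 dvd d}" "primepow d"
    then show "aprimedivisor d \<in> {3}"
      by (auto simp: primepow_def aprimedivisor_prime_power dest!: prime_dvd_power[rotated] primes_dvd_imp_eq[rotated 2])
  qed (use assms in auto)
  also have "(\<Sum>d | 3 * m < d \<and> d \<le> 6 * m \<and> d mod 3 = 1. mangoldt d :: real)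
      \<le> (\<Sum>d | d \<le> 6 * m \<and> d mod 3 = 2. mangoldt d)"
    using sum_mangoldt_1_mod_3_le_2_mod_3[of "2 * m"] by simp
  also have "(\<Sum>d | 3 * m < d \<and> d \<le> 6 * m \<and> d mod 3 = 2. mangoldt d :: real)
      \<le> (\<Sum>d | d \<le> 6 * m \<and> d mod 3 = 2. mangoldt d)"
    by (intro sum_mono2) (auto simp: mangoldt_nonneg)
  also have "(\<Sum>d | d \<le> 6 * m \<and> d mod 3 = 2. mangoldt d)
      \<le> real (card (primes_2_mod_3 (6 * m))) * ln (real (6 * m))"
  proof (rule sum_mangoldt_le_card_mult_ln)
    fix d :: nat assume d: "d \<in> {d. d \<le> 6 * m \<and> d mod 3 = 2}" "primepow d"
    then obtain p k where pk: "prime p" "k > 0" "d = p ^ k"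
      by (auto simp: primepow_def)
    have "p \<le> d"
      using pk by (intro dvd_imp_le) (auto simp: prime_gt_0_nat)
    then show "aprimedivisor d \<in> primes_2_mod_3 (6 * m)"
      using pk d prime_power_mod_3_eq_2[of p k] by (auto simp: primes_2_mod_3_def aprimedivisor_prime_power)
  qed (use assms in \<open>auto simp: Suc_le_eq intro: Nat.gr0I\<close>)
  finally show ?thesis
    by (simp add: algebra_simps)
qed

text \<open>At most sqrt N primes lie below sqrt N, costing 2N. Each larger prime has logarithm at
  least (ln N)/2, so those cost at most 2 psi(N) \<le> 18N.\<close>

lemma card_primes_upper:
  fixes N :: nat
  assumes "N > 0"
  shows "real (card {p. prime p \<and> p \<le> N}) * ln N \<le> 20 * N"
proof -
  define S where "S = {p. prime p \<and> p \<le> N \<and> p\<^sup>2 \<le> N}"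
  define T where "T = {p. prime p \<and> p \<le> N \<and> N < p\<^sup>2}"
  have fin: "finite S" "finite T"
    by (auto intro: finite_subset[of _ "{..N}"] simp: S_def T_def)
  have ln: "0 \<le> ln N" "ln N \<le> 2 * sqrt N" "sqrt N * sqrt N = N"
    using assms ln_le_2_sqrt[of N] by auto
  have "{p. prime p \<and> p \<le> N} = S \<union> T" "S \<inter> T = {}"
    by (auto simp: S_def T_def)
  then have "real (card {p. prime p \<and> p \<le> N}) = card S + card T"
    using fin by (simp add: card_Un_disjoint)
  moreover have "card S * ln N \<le> 2 * N"
  proof -
    have "S \<subseteq> {1..nat \<lfloor>sqrt N\<rfloor>}"
    proof
      fix p assume p: "p \<in> S"
      then have "(real p)\<^sup>2 \<le> real N"
        by (simp add: S_def flip: of_nat_power)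
      then have "real p \<le> sqrt N"
        by (rule real_le_rsqrt)
      then show "p \<in> {1..nat \<lfloor>sqrt N\<rfloor>}"
        using p by (simp add: S_def le_nat_floor prime_ge_Suc_0_nat)
    qed
    then have "card S \<le> nat \<lfloor>sqrt N\<rfloor>"
      using card_mono[of "{1..nat \<lfloor>sqrt N\<rfloor>}"] by simp
    then have "real (card S) \<le> sqrt N"
      by (simp add: le_nat_iff le_floor_iff)
    then have "card S * ln N \<le> sqrt N * (2 * sqrt N)"
      using ln by (intro mult_mono) auto
    then show ?thesis using ln(3) by linarith
  qed
  moreover have "card T * ln N \<le> 2 * psi N"
  proof -
    have "card T * (ln N / 2) = (\<Sum>p\<in>T. ln N / 2)"
      by simp
    also have "\<dots> \<le> (\<Sum>p\<in>T. mangoldt p)"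
    proof (rule sum_mono)
      fix p assume p: "p \<in> T"
      have "ln (real N) \<le> ln (real (p\<^sup>2))"
        using p assms by (subst ln_le_cancel_iff) (auto simp: T_def prime_gt_0_nat simp del: of_nat_power)
      then show "ln N / 2 \<le> mangoldt p"
        using p by (simp add: T_def ln_realpow prime_gt_0_nat)
    qed
    also have "\<dots> \<le> psi N"
      unfolding psi_def by (intro sum_mono2) (auto simp: T_def mangoldt_nonneg prime_ge_Suc_0_nat)
    finally show ?thesis by simp
  qed
  moreover have "psi N \<le> 9 * N"
  proof -
    have "ln (4 :: real) = 2 * ln 2"
      using ln_realpow[of 2 2] by simp
    then have "ln 4 \<le> (2 :: real)"
      using ln_le_minus_one[of "2 :: real"] by simp
    then have "ln 4 * real N \<le> 2 * real N"
      by (intro mult_right_mono) auto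
    moreover have "sqrt (real N) \<le> sqrt (real N) * sqrt (real N)"
      using assms mult_left_mono[of 1 "sqrt (real N)" "sqrt (real N)"] by simp
    ultimately show ?thesis
      using psi_upper[of N] ln(3) by linarith
  qed
  ultimately show ?thesis
    by (simp add: algebra_simps)
qed

lemma card_primes_le_primes_2_mod_3:
  fixes N :: nat
  assumes "N \<ge> 20000"
  shows "real (card {p. prime p \<and> p \<le> N}) \<le> 480 * real (card (primes_2_mod_3 N))"
proof -
  define m where "m = N div 6"
  have m: "m \<ge> 2700" "6 * m \<le> N" "N < 6 * m + 6"
    using assms by (auto simp: m_def)
  have lnpos: "ln N > 0"
    using assms by simp
  have sq: "sqrt N * sqrt N = N" "sqrt N \<ge> 100"
    using assms by (auto intro: real_le_rsqrt)
  have "real m \<le> (2 * real (card (primes_2_mod_3 (6 * m))) + 1) * ln (real (6 * m))"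
    by (rule card_primes_2_mod_3_lower) fact
  also have "\<dots> \<le> (2 * real (card (primes_2_mod_3 N)) + 1) * ln N"
  proof (intro mult_mono)
    have "card (primes_2_mod_3 (6 * m)) \<le> card (primes_2_mod_3 N)"
      using m(2) by (intro card_mono) (auto simp: primes_2_mod_3_def)
    then show "2 * real (card (primes_2_mod_3 (6 * m))) + 1 \<le> 2 * real (card (primes_2_mod_3 N)) + 1"
      by simp
    show "ln (real (6 * m)) \<le> ln N"
      using m by (subst ln_le_cancel_iff) auto
  qed (use m in auto)
  finally have "m - ln N \<le> 2 * (card (primes_2_mod_3 N) * ln N)"
    by (simp add: algebra_simps)
  moreover have "ln N \<le> 2 * sqrt N"
    using assms by (intro ln_le_2_sqrt) simp
  moreover have "100 * sqrt N \<le> N"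
    using mult_right_mono[OF sq(2), of "sqrt N"] sq(1) by simp
  moreover have "real N \<le> 6 * m + 6"
    using m(3) by linarith
  \<comment> \<open>With m \<ge> N/6 - 1 and ln N \<le> N/50, the left side \<open>m - ln N\<close>
    is at least N/12.\<close>
  ultimately have "N \<le> 24 * (card (primes_2_mod_3 N) * ln N)"
    using sq(2) by linarith
  \<comment> \<open>The constant 480 is 20 * 24, from the upper bound for all primes and the lower
    bound just found.\<close>
  then have "real (card {p. prime p \<and> p \<le> N}) * ln N \<le> 480 * real (card (primes_2_mod_3 N)) * ln N"
    using card_primes_upper[of N] assms by linarith
  then show ?thesis
    using lnpos by simp
qed

lemma lower_prime_density_pos:
  assumes "\<And>p. prime p \<Longrightarrow> p mod 3 = 2 \<Longrightarrow> p \<in> Q"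
  shows "lower_prime_density Q > 0"
proof -
  have "ereal (1 / 480)
      \<le> ereal (real (card (Q \<inter> {p. real p \<le> X})) / real (card (primes_upto X)))" if "X \<ge> 20000" for X
  proof -
    define N where "N = nat \<lfloor>X\<rfloor>"
    have le_iff: "real p \<le> X \<longleftrightarrow> p \<le> N" for p
      using that by (simp add: N_def le_nat_iff le_floor_iff)
    have N: "N \<ge> 20000"
      using that by (simp add: N_def le_nat_iff le_floor_iff)
    have upto: "primes_upto X = {p. prime p \<and> p \<le> N}"
      by (simp add: primes_upto_def le_iff)
    \<comment> \<open>The prime 2 keeps the denominator nonzero, so the quotient is a genuine
      one.\<close>
    have "2 \<in> primes_upto X" "finite (primes_upto X)"
      using N by (auto simp: upto intro: finite_subset[of _ "{..N}"])
    then have pos: "card (primes_upto X) > 0"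
      by (auto simp: card_gt_0_iff)
    have "card (primes_2_mod_3 N) \<le> card (Q \<inter> {p. real p \<le> X})"
      using assms by (intro card_mono) (auto simp: primes_2_mod_3_def le_iff)
    then have "real (card (primes_upto X)) \<le> 480 * real (card (Q \<inter> {p. real p \<le> X}))"
      using card_primes_le_primes_2_mod_3[OF N] by (simp add: upto)
    then show ?thesis
      using pos by (simp add: field_simps)
  qed
  then have "ereal (1 / 480) \<le> lower_prime_density Q"
    unfolding lower_prime_density_def
    by (intro Liminf_bounded eventually_mono[OF eventually_ge_at_top[of 20000]])
  moreover have "0 < ereal (1 / 480)" by simp
  ultimately show ?thesis by (rule less_le_trans[rotated])
qed

theorem corollary1p6:
  shows "positive_density_of_primes {p::nat. prime p \<and> (\<exists>x y z :: int. int p = cubic_form x y z)}"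
  unfolding positive_density_of_primes_def
  by (intro conjI lower_prime_density_pos) (auto intro: prime_2_mod_3_represented)

end
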